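(* Let $u\leq v$ in $S_n$, and let $B_{u,v}=\{B^1,\dots,B^r\}$ be the associated partition of $[n]$, with $\#B_{u,v}=r$ blocks. Then $$\dim \mathsf{Q}_{u,v}=n-\#B_{u,v},$$ and the equations defining the affine span of $\mathsf{Q}_{u,v}$ are $$\sum_{i\in B^j}x_i=\sum_{i\in B^j}u_i\ \Big(=\sum_{i\in B^j}v_i\Big),\qquad j=1,2,\dots,\#B_{u,v}.$$
   Context: $S_n$ carries the (strong) Bruhat order $\leq$, with cover relation $\lessdot$. Each $z\in S_n$ is identified with the vector $(z_1,\dots,z_n)=(z(1),\dots,z(n))\in\mathbb{R}^n$; for $u\leq v$ the Bruhat interval polytope $\mathsf{Q}_{u,v}$ is the convex hull of all vectors $z$ with $u\leq z\leq v$. For a maximal chain $\mathcal{C}: u=x_{(0)}\lessdot x_{(1)}\lessdot\cdots\lessdot x_{(l)}=v$, let $G^{\mathcal{C}}$ be the graph on vertex set $[n]$ with an edge between $a$ and $b$ if and only if the transposition $(a\,b)$ equals $x_{(i)}^{-1}x_{(i+1)}$ for some $0\leq i\leq l-1$ (products composed as functions). Let $B_{\mathcal{C}}$ be the partition of $[n]$ whose blocks are the connected components of $G^{\mathcal{C}}$. This partition is independent of the choice of $\mathcal{C}$ and is denoted $B_{u,v}$. *)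

theory Defs
  imports "HOL-Analysis.Analysis" "HOL-Combinatorics.Permutations"
begin

text \<open>
  The symmetric group on \<open>[n]\<close> is the set of functions \<open>z\<close> on \<open>nat\<close> with
  \<open>z permutes {1..n}\<close>; products are composed as functions.
\<close>

definition perm_length :: "nat \<Rightarrow> (nat \<Rightarrow> nat) \<Rightarrow> nat" where
  "perm_length n z = card {(i, j). 1 \<le> i \<and> i < j \<and> j \<le> n \<and> z j < z i}"

text \<open>Edges \<open>u \<rightarrow> u t\<close> of the Bruhat graph, \<open>t\<close> a transposition that increases the length.\<close>

definition bruhat_step :: "nat \<Rightarrow> (nat \<Rightarrow> nat) \<Rightarrow> (nat \<Rightarrow> nat) \<Rightarrow> bool" where
  "bruhat_step n u v \<longleftrightarrow>
     (\<exists>a\<in>{1..n}. \<exists>b\<in>{1..n}. a \<noteq> b \<and> v = u \<circ> Transposition.transpose a b) \<and>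
     perm_length n u < perm_length n v"

definition bruhat_le :: "nat \<Rightarrow> (nat \<Rightarrow> nat) \<Rightarrow> (nat \<Rightarrow> nat) \<Rightarrow> bool" where
  "bruhat_le n u v \<longleftrightarrow> u permutes {1..n} \<and> v permutes {1..n} \<and> (bruhat_step n)\<^sup>*\<^sup>* u v"

definition bruhat_cover :: "nat \<Rightarrow> (nat \<Rightarrow> nat) \<Rightarrow> (nat \<Rightarrow> nat) \<Rightarrow> bool" where
  "bruhat_cover n u v \<longleftrightarrow> bruhat_le n u v \<and> u \<noteq> v \<and>
     (\<forall>w. bruhat_le n u w \<and> bruhat_le n w v \<longrightarrow> w = u \<or> w = v)"

definition maximal_chain ::
  "nat \<Rightarrow> (nat \<Rightarrow> nat) \<Rightarrow> (nat \<Rightarrow> nat) \<Rightarrow> (nat \<Rightarrow> nat) list \<Rightarrow> bool" where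
  "maximal_chain n u v C \<longleftrightarrow>
     u permutes {1..n} \<and> v permutes {1..n} \<and>
     C \<noteq> [] \<and> hd C = u \<and> last C = v \<and> successively (bruhat_cover n) C"

definition chain_edges :: "nat \<Rightarrow> (nat \<Rightarrow> nat) list \<Rightarrow> (nat \<times> nat) set" where
  "chain_edges n C = {(a, b). a \<in> {1..n} \<and> b \<in> {1..n} \<and> a \<noteq> b \<and>
     (\<exists>i. Suc i < length C \<and> Transposition.transpose a b = inv (C ! i) \<circ> C ! Suc i)}"

text \<open>
  The edge relation is symmetric, so its reflexive transitive closure is connectedness in the
  graph and the quotient of the vertex set is the set of connected components.
\<close>

definition chain_partition :: "nat \<Rightarrow> (nat \<Rightarrow> nat) list \<Rightarrow> nat set set" where
  "chain_partition n C = {1..n} // (chain_edges n C)\<^sup>*"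

text \<open>The common value of \<open>chain_partition\<close> on all maximal chains from \<open>u\<close> to \<open>v\<close>.\<close>

definition bruhat_partition :: "nat \<Rightarrow> (nat \<Rightarrow> nat) \<Rightarrow> (nat \<Rightarrow> nat) \<Rightarrow> nat set set" where
  "bruhat_partition n u v =
     (THE B. \<exists>C. maximal_chain n u v C \<and> B = chain_partition n C)"

text \<open>
  The coordinates of \<open>real ^ 'n\<close> are labelled by \<open>1, \<dots>, n\<close> through a bijection \<open>e\<close> from
  \<open>{1..n}\<close> to \<open>'n\<close>: the \<open>i\<close>-th coordinate of \<open>x\<close> is \<open>x $ e i\<close>. In particular
  \<open>n = CARD('n)\<close>, and each permutation is identified with exactly one vector.
\<close>

definition bruhat_interval_polytope ::
  "nat \<Rightarrow> (nat \<Rightarrow> 'n::finite) \<Rightarrow> (nat \<Rightarrow> nat) \<Rightarrow> (nat \<Rightarrow> nat) \<Rightarrow> (real ^ 'n) set" where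
  "bruhat_interval_polytope n e u v =
     convex hull {x. \<exists>z. bruhat_le n u z \<and> bruhat_le n z v \<and> (\<forall>i\<in>{1..n}. x $ e i = real (z i))}"

end

theory Submission
  imports Defs
begin

text \<open>
  Fix a maximal chain \<open>C\<close> from \<open>u\<close> to \<open>v\<close>. If \<open>y = x \<circ> (a b)\<close> are consecutive in \<open>C\<close>, then as
  vectors \<open>y - x = (x b - x a) (e\<^sub>a - e\<^sub>b)\<close>, a nonzero multiple of \<open>e\<^sub>a - e\<^sub>b\<close>. Hence the direction
  space of the polytope contains every \<open>e\<^sub>a - e\<^sub>b\<close> with \<open>a, b\<close> in one connected component of the
  graph of \<open>C\<close>, and these span all vectors whose sum over each block is zero. This gives
  one inclusion, and the dimension is then that of the orthogonal complement of the block
  indicators.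

  For the converse inclusion, all \<open>z\<close> in \<open>[u, v]\<close> must have the same block sums as \<open>u\<close>. Colour each
  position \<open>i\<close> by its block \<open>f i\<close>. The composition \<open>f \<circ> inv z\<close> records which colour holds each value, and
  it determines the block sums of \<open>z\<close>. Since an edge \<open>x \<rightarrow> x \<circ> (a b)\<close> preserves it exactly
  when \<open>f a = f b\<close>, it is constant along \<open>C\<close>. The combinatorial core,
  \<open>colour_constant_on_interval\<close>, is that \<open>f \<circ> inv z\<close> is constant for \<open>z\<close> in the whole interval
  \<open>[u, v]\<close> as soon as it is constant along one maximal chain. Applied to the edges of a second maximal chain, the
  same lemma shows that the partition does not depend on the chain.

  The core lemma is an induction on the length of \<open>v\<close>. Left multiplication by the adjacent
  transposition \<open>s = (j j+1)\<close> acts on values, so it does not change the transposition labelling an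
  edge, and it turns \<open>f \<circ> inv x\<close> into \<open>f \<circ> inv x \<circ> s\<close>. Choose \<open>s\<close> with \<open>s v < v\<close>. The lifting
  property (\<open>lift_lower\<close>, \<open>lift_upper\<close>) turns the given chain into a chain of the same kind that ends in
  \<open>s v\<close>, and places \<open>z\<close> or \<open>s z\<close> in the shorter interval.
\<close>

section \<open>Edges of the Bruhat graph\<close>

abbreviation transposition :: "nat \<Rightarrow> nat \<Rightarrow> nat \<Rightarrow> nat" where
  "transposition a b \<equiv> Transposition.transpose a b"

text \<open>
  For a third position \<open>c\<close>, the two pairs formed with \<open>a\<close> and with \<open>b\<close> carry at least as many
  inversions after the exchange as before. The map \<open>g\<close> turns this into an injection: it moves a pair
  along the transposition when that keeps its two positions in order, and fixes it otherwise.
  The inversion \<open>(a, b)\<close> itself is new.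
\<close>

lemma perm_length_less:
  assumes x: "inj x" and ab: "1 \<le> a" "a < b" "b \<le> n" "x a < x b"
  shows "perm_length n x < perm_length n (x \<circ> transposition a b)"
proof -
  let ?t = "transposition a b"
  define Inv where "Inv = (\<lambda>y::nat \<Rightarrow> nat. {(i, j). 1 \<le> i \<and> i < j \<and> j \<le> n \<and> y j < y i})"
  define g where "g = (\<lambda>(i, j). if ?t i < ?t j then (?t i, ?t j) else (i, j))"
  have fin: "finite (Inv y)" for y
    by (rule finite_subset[of _ "{1..n} \<times> {1..n}"]) (auto simp: Inv_def)
  have t_eq: "?t i = ?t k \<longleftrightarrow> i = k" for i k by (rule inj_eq[OF inj_transpose])
  have "inj_on g (Inv x)"
    by (rule inj_onI) (auto simp: g_def Inv_def t_eq split: if_splits)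
  moreover have "g ` Inv x \<subset> Inv (x \<circ> ?t)"
  proof -
    have "g p \<in> Inv (x \<circ> ?t)" if "p \<in> Inv x" for p
    proof -
      obtain i j where p: "p = (i, j)" by force
      have ij: "1 \<le> i" "i < j" "j \<le> n" "x j < x i" using that by (auto simp: Inv_def p)
      consider "i = a" | "i = b" | "i \<noteq> a" "i \<noteq> b" "j = a" | "i \<noteq> a" "i \<noteq> b" "j = b"
        | "i \<noteq> a" "i \<noteq> b" "j \<noteq> a" "j \<noteq> b" by blast
      then show ?thesis
        using ij ab by cases (auto simp: p g_def Inv_def Transposition.transpose_def)
    qed
    moreover have "(a, b) \<in> Inv (x \<circ> ?t)" using ab by (auto simp: Inv_def)
    moreover have "(a, b) \<notin> g ` Inv x"
    proof
      assume "(a, b) \<in> g ` Inv x"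
      then obtain i j where ij: "(i, j) \<in> Inv x" and g: "g (i, j) = (a, b)" by (metis imageE surj_pair)
      show False
      proof (cases "?t i < ?t j")
        case True
        then have "?t i = a" "?t j = b" using g by (auto simp: g_def)
        then have "i = b" "j = a" by (metis transpose_apply_first transpose_apply_second t_eq)+
        then show False using ij ab by (auto simp: Inv_def)
      next
        case False
        then show False using g ij ab by (auto simp: g_def Inv_def)
      qed
    qed
    ultimately show ?thesis by blast
  qed
  ultimately have "card (Inv x) < card (Inv (x \<circ> ?t))"
    by (metis card_image fin psubset_card_mono)
  then show ?thesis by (simp add: Inv_def perm_length_def)
qed

lemma bruhat_step_iff:
  assumes x: "x permutes {1..n}"
  shows "bruhat_step n x y \<longleftrightarrow>
    (\<exists>a b. 1 \<le> a \<and> a < b \<and> b \<le> n \<and> x a < x b \<and> y = x \<circ> transposition a b)"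
    (is "_ \<longleftrightarrow> ?R")
proof
  assume "bruhat_step n x y"
  then obtain a b where ab: "a \<in> {1..n}" "b \<in> {1..n}" "a < b" and y: "y = x \<circ> transposition a b"
    and l: "perm_length n x < perm_length n y"
    unfolding bruhat_step_def by (metis linorder_neqE transpose_commute)
  have "x a < x b"
  proof (rule ccontr)
    assume "\<not> x a < x b"
    moreover have "x a \<noteq> x b" using ab inj_eq[OF permutes_inj[OF x]] by simp
    ultimately have "y a < y b" by (simp add: y)
    moreover have "inj y"
      unfolding y using permutes_inj[OF x] by (auto intro!: inj_compose)
    moreover have "y \<circ> transposition a b = x" by (simp add: y fun_eq_iff)
    ultimately have "perm_length n y < perm_length n x"
      using perm_length_less[of y a b n] ab by auto
    with l show False by simp
  qed
  with ab y show ?R by auto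
next
  assume ?R
  then show "bruhat_step n x y"
    using perm_length_less[OF permutes_inj[OF x]] unfolding bruhat_step_def
    by (metis atLeastAtMost_iff less_imp_le_nat less_irrefl order_trans)
qed

section \<open>The Bruhat order\<close>

lemma bruhat_step_permutes:
  assumes "bruhat_step n x y" "x permutes {1..n}" shows "y permutes {1..n}"
proof -
  obtain a b where ab: "a \<in> {1..n}" "b \<in> {1..n}" and y: "y = x \<circ> transposition a b"
    using assms(1) unfolding bruhat_step_def by blast
  show ?thesis unfolding y by (rule permutes_compose[OF permutes_swap_id[OF ab] assms(2)])
qed

lemma bruhat_le_step: "x permutes {1..n} \<Longrightarrow> bruhat_step n x y \<Longrightarrow> bruhat_le n x y"
  unfolding bruhat_le_def using bruhat_step_permutes by blast

lemma bruhat_le_refl: "x permutes {1..n} \<Longrightarrow> bruhat_le n x x"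
  by (simp add: bruhat_le_def)

lemma bruhat_le_trans: "bruhat_le n x y \<Longrightarrow> bruhat_le n y z \<Longrightarrow> bruhat_le n x z"
  by (auto simp: bruhat_le_def)

lemma bruhat_le_permutes:
  "bruhat_le n x y \<Longrightarrow> x permutes {1..n}" "bruhat_le n x y \<Longrightarrow> y permutes {1..n}"
  by (auto simp: bruhat_le_def)

lemma perm_length_strict_mono:
  assumes "bruhat_le n x y" "x \<noteq> y" shows "perm_length n x < perm_length n y"
proof -
  have "(bruhat_step n)\<^sup>*\<^sup>* x y" using assms by (simp add: bruhat_le_def)
  then have "x = y \<or> perm_length n x < perm_length n y"
    by induction (auto simp: bruhat_step_def)
  with assms show ?thesis by simp
qed

lemma bruhat_le_antisym: "bruhat_le n x y \<Longrightarrow> bruhat_le n y x \<Longrightarrow> x = y"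
  by (metis perm_length_strict_mono less_asym)

lemma bruhat_cover_le: "bruhat_cover n x y \<Longrightarrow> bruhat_le n x y"
  by (simp add: bruhat_cover_def)

lemma bruhat_cover_step:
  assumes "bruhat_cover n x y" shows "bruhat_step n x y"
proof -
  have xy: "x permutes {1..n}" "y permutes {1..n}" "x \<noteq> y" "(bruhat_step n)\<^sup>*\<^sup>* x y"
    using assms by (auto simp: bruhat_cover_def bruhat_le_def)
  then obtain w where w: "bruhat_step n x w" "(bruhat_step n)\<^sup>*\<^sup>* w y"
    by (metis converse_rtranclpE)
  then have "w = x \<or> w = y"
    using assms xy bruhat_step_permutes[OF w(1) xy(1)]
    unfolding bruhat_cover_def bruhat_le_def by blast
  then show ?thesis using w by (auto simp: bruhat_step_def)
qed

section \<open>Left multiplication by an adjacent transposition\<close>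

definition swap_values :: "nat \<Rightarrow> (nat \<Rightarrow> nat) \<Rightarrow> nat \<Rightarrow> nat" where
  "swap_values j x = transposition j (Suc j) \<circ> x"

definition left_ascent :: "nat \<Rightarrow> (nat \<Rightarrow> nat) \<Rightarrow> bool" where
  "left_ascent j x \<longleftrightarrow> inv x j < inv x (Suc j)"

lemma swap_values_swap_values [simp]: "swap_values j (swap_values j x) = x"
  by (simp add: swap_values_def fun_eq_iff)

lemma swap_values_permutes:
  assumes "x permutes {1..n}" "1 \<le> j" "j < n" shows "swap_values j x permutes {1..n}"
  unfolding swap_values_def using assms by (intro permutes_compose permutes_swap_id) auto

lemma inv_swap_values:
  assumes "x permutes {1..n}" shows "inv (swap_values j x) = inv x \<circ> transposition j (Suc j)"
  using assms by (simp add: swap_values_def o_inv_distrib permutes_bij)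

lemma left_ascent_swap_values:
  assumes "x permutes {1..n}" shows "left_ascent j (swap_values j x) \<longleftrightarrow> \<not> left_ascent j x"
proof -
  have "inv x j \<noteq> inv x (Suc j)"
    by (simp add: inj_eq[OF permutes_inj[OF permutes_inv[OF assms]]])
  then show ?thesis by (auto simp: left_ascent_def inv_swap_values[OF assms])
qed

lemma comp_transposition:
  assumes "inj x" shows "x \<circ> transposition a b = transposition (x a) (x b) \<circ> x"
proof
  fix i
  show "(x \<circ> transposition a b) i = (transposition (x a) (x b) \<circ> x) i"
    unfolding o_apply Transposition.transpose_def by (simp only: inj_eq[OF assms] split: if_split) blast
qed

lemma left_ascent_le:
  assumes x: "x permutes {1..n}" and j: "1 \<le> j" "j < n" and a: "left_ascent j x"
  shows "bruhat_le n x (swap_values j x)"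
proof -
  have i: "inv x permutes {1..n}" by (rule permutes_inv[OF x])
  have "inv x j \<in> {1..n}" "inv x (Suc j) \<in> {1..n}"
    using permutes_in_image[OF i, of j] permutes_in_image[OF i, of "Suc j"] j by auto
  moreover have "swap_values j x = x \<circ> transposition (inv x j) (inv x (Suc j))"
    by (simp add: swap_values_def comp_transposition[OF permutes_inj[OF x]] permutes_inverses[OF x])
  moreover have "x (inv x j) < x (inv x (Suc j))" by (simp add: permutes_inverses[OF x])
  ultimately have "bruhat_step n x (swap_values j x)"
    unfolding bruhat_step_iff[OF x] using a unfolding left_ascent_def
    by (intro exI[of _ "inv x j"] exI[of _ "inv x (Suc j)"]) simp
  then show ?thesis by (rule bruhat_le_step[OF x])
qed

lemma left_descent_le:
  assumes x: "x permutes {1..n}" and j: "1 \<le> j" "j < n" and d: "\<not> left_ascent j x"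
  shows "bruhat_le n (swap_values j x) x"
  using left_ascent_le[OF swap_values_permutes[OF x j] j] d left_ascent_swap_values[OF x] by simp

text \<open>
  The exchanged values keep their relative order under the adjacent transposition unless they are
  \<open>j\<close> and \<open>j + 1\<close> themselves, in which case the edge is that adjacent transposition.
\<close>

lemma bruhat_step_swap_values:
  assumes x: "x permutes {1..n}" and j: "1 \<le> j" "j < n" and s: "bruhat_step n x y"
  shows "y = swap_values j x \<or> bruhat_step n (swap_values j x) (swap_values j y)"
proof -
  obtain a b where ab: "1 \<le> a" "a < b" "b \<le> n" "x a < x b" and y: "y = x \<circ> transposition a b"
    using s unfolding bruhat_step_iff[OF x] by blast
  show ?thesis
  proof (cases "x a = j \<and> x b = Suc j")
    case True
    then show ?thesis by (simp add: y swap_values_def comp_transposition[OF permutes_inj[OF x]])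
  next
    case False
    then have "swap_values j x a < swap_values j x b"
      using ab by (auto simp: swap_values_def Transposition.transpose_def)
    with ab y show ?thesis
      unfolding bruhat_step_iff[OF swap_values_permutes[OF x j]] by (auto simp: swap_values_def o_assoc)
  qed
qed

text \<open>
  One half of the lifting property: push the whole path from \<open>x\<close> to \<open>y\<close> through left multiplication.
  If no edge of the path is that multiplication, the image ends in \<open>swap_values j y\<close>, which is below
  \<open>y\<close>. Otherwise the image rejoins the path at its first such edge, from \<open>w\<close> to \<open>swap_values j w\<close>,
  and follows it to \<open>y\<close>.
\<close>

lemma lift_lower:
  assumes le: "bruhat_le n x y" and j: "1 \<le> j" "j < n" and d: "\<not> left_ascent j y"
  shows "bruhat_le n (swap_values j x) y"
proof -
  have y: "y permutes {1..n}" and steps: "(bruhat_step n)\<^sup>*\<^sup>* x y" and x: "x permutes {1..n}"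
    using le by (auto simp: bruhat_le_def)
  show ?thesis using steps x
  proof (induction rule: converse_rtranclp_induct)
    case base
    show ?case by (rule left_descent_le[OF y j d])
  next
    case (step x w)
    have w: "w permutes {1..n}" by (rule bruhat_step_permutes[OF step.hyps(1) step.prems])
    from bruhat_step_swap_values[OF step.prems j step.hyps(1)] show ?case
    proof
      assume "w = swap_values j x"
      with step.hyps(2) w y show ?thesis by (simp add: bruhat_le_def)
    next
      assume "bruhat_step n (swap_values j x) (swap_values j w)"
      then show ?thesis
        using bruhat_le_step[OF swap_values_permutes[OF step.prems j]] step.IH[OF w]
          bruhat_le_trans by blast
    qed
  qed
qed

text \<open>
  The other half of the lifting property, by the dual argument from the upper end of the path.
\<close>

lemma lift_upper:
  assumes le: "bruhat_le n x y" and j: "1 \<le> j" "j < n" and a: "left_ascent j x"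
  shows "bruhat_le n x (swap_values j y)"
proof -
  have y: "y permutes {1..n}" and steps: "(bruhat_step n)\<^sup>*\<^sup>* x y" and x: "x permutes {1..n}"
    using le by (auto simp: bruhat_le_def)
  show ?thesis using steps y
  proof (induction rule: rtranclp_induct)
    case base
    show ?case by (rule left_ascent_le[OF x j a])
  next
    case (step w y)
    have w: "w permutes {1..n}"
      using step.hyps(1) x by (induction rule: rtranclp_induct) (use bruhat_step_permutes in blast)+
    from bruhat_step_swap_values[OF w j step.hyps(2)] show ?case
    proof
      assume "y = swap_values j w"
      then show ?thesis using step.hyps(1) w x by (simp add: bruhat_le_def)
    next
      assume "bruhat_step n (swap_values j w) (swap_values j y)"
      then show ?thesis
        using bruhat_le_step[OF swap_values_permutes[OF w j]] step.IH[OF w]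
          bruhat_le_trans by blast
    qed
  qed
qed

lemma descents_mono:
  assumes le: "bruhat_le n x y" and j: "1 \<le> j" "j < n" and d: "\<not> left_ascent j x"
  shows "bruhat_le n (swap_values j x) (swap_values j y)"
proof -
  have x: "x permutes {1..n}" using le by (rule bruhat_le_permutes)
  have "bruhat_le n (swap_values j x) y"
    using left_descent_le[OF x j d] le by (rule bruhat_le_trans)
  then show ?thesis using left_ascent_swap_values[OF x] d j by (intro lift_upper) auto
qed

lemma ascents_mono:
  assumes le: "bruhat_le n x y" and j: "1 \<le> j" "j < n" and a: "left_ascent j y"
  shows "bruhat_le n (swap_values j x) (swap_values j y)"
proof -
  have y: "y permutes {1..n}" using le by (rule bruhat_le_permutes)
  have "bruhat_le n x (swap_values j y)"
    using le left_ascent_le[OF y j a] by (rule bruhat_le_trans)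
  then show ?thesis using left_ascent_swap_values[OF y] a j by (intro lift_lower) auto
qed

section \<open>Covers and adjacent transpositions\<close>

text \<open>
  By lifting, \<open>swap_values j y\<close> lies between \<open>x\<close> and \<open>y\<close>; a cover leaves only \<open>x\<close>. Thus a saturated
  chain can pass from left ascents to left descents only along the adjacent transposition.
\<close>

lemma cover_ascent_to_descent:
  assumes c: "bruhat_cover n x y" and j: "1 \<le> j" "j < n"
    and x: "left_ascent j x" and y: "\<not> left_ascent j y"
  shows "y = swap_values j x"
proof -
  note p = bruhat_le_permutes[OF bruhat_cover_le[OF c]]
  have "bruhat_le n x (swap_values j y)"
    by (rule lift_upper[OF bruhat_cover_le[OF c] j x])
  moreover have "bruhat_le n (swap_values j y) y" by (rule left_descent_le[OF p(2) j y])
  moreover have "swap_values j y \<noteq> y" using left_ascent_swap_values[OF p(2), of j] by metis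
  ultimately have "swap_values j y = x" using c unfolding bruhat_cover_def by blast
  then show ?thesis using swap_values_swap_values[of j y] by simp
qed

lemma cover_swap_values_descent:
  assumes u: "u permutes {1..n}" and j: "1 \<le> j" "j < n" and d: "\<not> left_ascent j u"
  shows "bruhat_cover n (swap_values j u) u"
  unfolding bruhat_cover_def
proof (intro conjI allI impI)
  have a: "left_ascent j (swap_values j u)" using left_ascent_swap_values[OF u] d by simp
  show "bruhat_le n (swap_values j u) u" by (rule left_descent_le[OF u j d])
  show "swap_values j u \<noteq> u" using a d by metis
  fix w assume w: "bruhat_le n (swap_values j u) w \<and> bruhat_le n w u"
  show "w = swap_values j u \<or> w = u"
  proof (cases "left_ascent j w")
    case True
    then have "bruhat_le n w (swap_values j u)" using w j by (intro lift_upper) auto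
    then show ?thesis using w bruhat_le_antisym by blast
  next
    case False
    then have "bruhat_le n u w" using w j lift_lower[of n "swap_values j u" w j] by simp
    then show ?thesis using w bruhat_le_antisym by blast
  qed
qed

text \<open>
  An element \<open>w\<close> between the images yields one between \<open>x\<close> and \<open>y\<close>, hence \<open>x\<close> or \<open>y\<close>. If \<open>w\<close> has an
  ascent, this is \<open>swap_values j w\<close>, and \<open>w\<close> is one of the images. If \<open>w\<close> has a descent, it is \<open>w\<close> itself,
  and then \<open>swap_values j y\<close> would lie between \<open>x\<close> and \<open>y\<close>, which is impossible because it has an ascent.
\<close>

lemma cover_swap_values_descents:
  assumes c: "bruhat_cover n x y" and j: "1 \<le> j" "j < n"
    and dx: "\<not> left_ascent j x" and dy: "\<not> left_ascent j y"
  shows "bruhat_cover n (swap_values j x) (swap_values j y)"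
  unfolding bruhat_cover_def
proof (intro conjI allI impI)
  note le = bruhat_cover_le[OF c]
  note p = bruhat_le_permutes[OF le]
  have ax: "left_ascent j (swap_values j x)" and ay: "left_ascent j (swap_values j y)"
    using left_ascent_swap_values p dx dy by auto
  have between: "w = x \<or> w = y" if "bruhat_le n x w" "bruhat_le n w y" for w
    using c that by (auto simp: bruhat_cover_def)
  show "bruhat_le n (swap_values j x) (swap_values j y)" by (rule descents_mono[OF le j dx])
  show "swap_values j x \<noteq> swap_values j y"
  proof
    assume "swap_values j x = swap_values j y"
    then have "swap_values j (swap_values j x) = swap_values j (swap_values j y)" by (rule arg_cong)
    then show False using c by (simp add: bruhat_cover_def)
  qed
  fix w assume w: "bruhat_le n (swap_values j x) w \<and> bruhat_le n w (swap_values j y)"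
  show "w = swap_values j x \<or> w = swap_values j y"
  proof (cases "left_ascent j w")
    case True
    have "bruhat_le n x (swap_values j w)"
      using ascents_mono[of n "swap_values j x" w j] w j True by simp
    moreover have "bruhat_le n (swap_values j w) y"
      using ascents_mono[of n w "swap_values j y" j] w j ay by simp
    ultimately have "swap_values j w = x \<or> swap_values j w = y" by (rule between)
    then show ?thesis using swap_values_swap_values[of j w] by auto
  next
    case False
    have "bruhat_le n x w" using lift_lower[of n "swap_values j x" w j] w j False by simp
    moreover have "bruhat_le n w y"
      using w left_descent_le[OF p(2) j dy] bruhat_le_trans by blast
    ultimately have "w = x \<or> w = y" by (rule between)
    moreover have "w \<noteq> y"
    proof
      assume "w = y"
      then have "swap_values j y = y"
        using w left_descent_le[OF p(2) j dy] bruhat_le_antisym by blast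
      then show False using ay dy by simp
    qed
    ultimately have "bruhat_le n x (swap_values j y)" using w by simp
    then have "swap_values j y = x \<or> swap_values j y = y"
      using between left_descent_le[OF p(2) j dy] by blast
    then show ?thesis using ay dx dy by auto
  qed
qed

text \<open>
  Without a left descent the inverse would be increasing on \<open>{1..n}\<close>, so there would be no inversion.
\<close>

lemma exists_left_descent:
  assumes v: "v permutes {1..n}" and l: "0 < perm_length n v"
  obtains j where "1 \<le> j" "j < n" "\<not> left_ascent j v"
proof -
  have "\<exists>j. 1 \<le> j \<and> j < n \<and> \<not> left_ascent j v"
  proof (rule ccontr)
    assume *: "\<not> ?thesis"
    then have asc: "inv v j < inv v (Suc j)" if "1 \<le> j" "j < n" for j
      using that by (auto simp: left_ascent_def)
    have mono: "k < m \<Longrightarrow> m \<le> n \<Longrightarrow> inv v k < inv v m" if "1 \<le> k" for k m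
    proof (induction m)
      case (Suc m)
      then show ?case
        using asc[of m] that by (cases "k = m") auto
    qed simp
    obtain a b where ab: "1 \<le> a" "a < b" "b \<le> n" "v b < v a"
      using l unfolding perm_length_def card_gt_0_iff by auto
    then have "v b \<in> {1..n}" "v a \<in> {1..n}"
      using permutes_in_image[OF v, of a] permutes_in_image[OF v, of b] by auto
    then have "inv v (v b) < inv v (v a)" using mono ab(4) by simp
    then show False using ab(2) by (simp add: permutes_inverses[OF v])
  qed
  then show thesis using that by blast
qed

section \<open>Colourings along intervals\<close>

text \<open>
  The composition \<open>f \<circ> inv x\<close> assigns to a value the colour of the position where it stands. Two
  permutations have the same one exactly when they lie in the same coset of the group of
  permutations that preserve the colours of positions.
\<close>

definition coloured_cover ::
  "nat \<Rightarrow> (nat \<Rightarrow> 'c) \<Rightarrow> (nat \<Rightarrow> nat) \<Rightarrow> (nat \<Rightarrow> nat) \<Rightarrow> bool" where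
  "coloured_cover n f x y \<longleftrightarrow> bruhat_cover n x y \<and> f \<circ> inv x = f \<circ> inv y"

lemma coloured_covers_colour:
  assumes "(coloured_cover n f)\<^sup>*\<^sup>* x y" shows "f \<circ> inv x = f \<circ> inv y"
  using assms by (induction rule: rtranclp_induct) (auto simp: coloured_cover_def)

lemma colour_swap_values:
  assumes "x permutes {1..n}"
  shows "f \<circ> inv (swap_values j x) = f \<circ> inv x \<circ> transposition j (Suc j)"
  using inv_swap_values[OF assms] by (simp add: o_assoc)

lemma colour_swap_values_cong:
  assumes "x permutes {1..n}" "y permutes {1..n}" "f \<circ> inv x = f \<circ> inv y"
  shows "f \<circ> inv (swap_values j x) = f \<circ> inv (swap_values j y)"
  using assms by (simp add: colour_swap_values)

text \<open>
  The chain starts in an ascent and ends in a descent, so it crosses from ascents to descents, by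
  an edge that is left multiplication by the adjacent transposition. Deleting the last
  such edge, and multiplying all that follows it, gives a chain to \<open>swap_values j v\<close>. As the deleted
  edge preserves colours, exchanging the colours of the values \<open>j\<close> and \<open>j + 1\<close> changes nothing.
\<close>

lemma coloured_covers_from_ascent:
  assumes u: "u permutes {1..n}" and j: "1 \<le> j" "j < n" and a: "left_ascent j u"
    and uv: "(coloured_cover n f)\<^sup>*\<^sup>* u v" and d: "\<not> left_ascent j v"
  shows "(coloured_cover n f)\<^sup>*\<^sup>* u (swap_values j v) \<and> f \<circ> inv (swap_values j u) = f \<circ> inv u"
  using uv d
proof (induction rule: rtranclp_induct)
  case base
  then show ?case using a by simp
next
  case (step y z)
  then have c: "bruhat_cover n y z" and yz: "f \<circ> inv y = f \<circ> inv z"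
    by (auto simp: coloured_cover_def)
  note p = bruhat_le_permutes[OF bruhat_cover_le[OF c]]
  show ?case
  proof (cases "left_ascent j y")
    case True
    then have z: "z = swap_values j y"
      using cover_ascent_to_descent[OF c j] step.prems by blast
    have uy: "f \<circ> inv u = f \<circ> inv y" by (rule coloured_covers_colour[OF step.hyps(1)])
    have "f \<circ> inv (swap_values j u) = f \<circ> inv z"
      unfolding z by (rule colour_swap_values_cong[OF u p(1) uy])
    then show ?thesis using step.hyps(1) uy yz z by simp
  next
    case False
    then have "coloured_cover n f (swap_values j y) (swap_values j z)"
      using cover_swap_values_descents[OF c j] step.prems
        colour_swap_values_cong[OF p yz, of j] unfolding coloured_cover_def by blast
    with step.IH[OF False] show ?thesis by (metis (no_types, lifting) rtranclp.rtrancl_into_rtrancl)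
  qed
qed

text \<open>
  If every element of the chain has a descent, multiply the whole chain. Otherwise its last ascent is
  followed by an edge given by the adjacent transposition. Colours are then invariant under exchanging
  \<open>j\<close> and \<open>j + 1\<close>, so \<open>swap_values j u\<close> can be put below \<open>u\<close> as a first coloured cover, while that
  later edge is deleted and all that follows it is multiplied.
\<close>

lemma coloured_covers_from_descent:
  assumes u: "u permutes {1..n}" and j: "1 \<le> j" "j < n" and du: "\<not> left_ascent j u"
    and uv: "(coloured_cover n f)\<^sup>*\<^sup>* u v" and d: "\<not> left_ascent j v"
  shows "(coloured_cover n f)\<^sup>*\<^sup>* (swap_values j u) (swap_values j v)"
  using uv d
proof (induction rule: rtranclp_induct)
  case base
  show ?case by simp
next
  case (step y z)
  then have c: "bruhat_cover n y z" and yz: "f \<circ> inv y = f \<circ> inv z"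
    by (auto simp: coloured_cover_def)
  note p = bruhat_le_permutes[OF bruhat_cover_le[OF c]]
  show ?case
  proof (cases "left_ascent j y")
    case True
    then have z: "z = swap_values j y"
      using cover_ascent_to_descent[OF c j] step.prems by blast
    have uy: "f \<circ> inv u = f \<circ> inv y" by (rule coloured_covers_colour[OF step.hyps(1)])
    have "f \<circ> inv (swap_values j u) = f \<circ> inv z"
      unfolding z by (rule colour_swap_values_cong[OF u p(1) uy])
    then have "coloured_cover n f (swap_values j u) u"
      using cover_swap_values_descent[OF u j du] uy yz by (simp add: coloured_cover_def)
    then have "(coloured_cover n f)\<^sup>*\<^sup>* (swap_values j u) y"
      using step.hyps(1) by (rule converse_rtranclp_into_rtranclp)
    then show ?thesis by (simp add: z)
  next
    case False
    then have "coloured_cover n f (swap_values j y) (swap_values j z)"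
      using cover_swap_values_descents[OF c j] step.prems
        colour_swap_values_cong[OF p yz, of j] unfolding coloured_cover_def by blast
    with step.IH[OF False] show ?thesis by (metis (no_types, lifting) rtranclp.rtrancl_into_rtrancl)
  qed
qed

text \<open>
  The chain argument moves the upper end to \<open>swap_values j v\<close>, and the lifting property moves \<open>z\<close> or
  \<open>swap_values j z\<close> into the shorter interval.
\<close>

lemma colour_constant_on_interval:
  assumes "(coloured_cover n f)\<^sup>*\<^sup>* u v" "bruhat_le n u z" "bruhat_le n z v"
  shows "f \<circ> inv z = f \<circ> inv u"
  using assms
proof (induction "perm_length n v" arbitrary: u v z rule: less_induct)
  case less
  note u = bruhat_le_permutes(1)[OF less.prems(2)] and z = bruhat_le_permutes(1)[OF less.prems(3)]
    and v = bruhat_le_permutes(2)[OF less.prems(3)]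
  have uv: "bruhat_le n u v" using less.prems bruhat_le_trans by blast
  show ?case
  proof (cases "u = v")
    case True
    then show ?thesis using less.prems bruhat_le_antisym by blast
  next
    case False
    then have "0 < perm_length n v" using perm_length_strict_mono[OF uv] by simp
    then obtain j where j: "1 \<le> j" "j < n" and d: "\<not> left_ascent j v"
      using exists_left_descent[OF v] by blast
    have "swap_values j v \<noteq> v" using left_ascent_swap_values[OF v, of j] by metis
    then have shorter: "perm_length n (swap_values j v) < perm_length n v"
      by (rule perm_length_strict_mono[OF left_descent_le[OF v j d]])
    note IH = less.hyps[OF shorter]
    have z_up: "bruhat_le n z (swap_values j v)" if "left_ascent j z"
      by (rule lift_upper[OF less.prems(3) j that])
    have z_down: "bruhat_le n (swap_values j z) (swap_values j v)" if "\<not> left_ascent j z"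
      by (rule descents_mono[OF less.prems(3) j that])
    show ?thesis
    proof (cases "left_ascent j u")
      case True
      note c = coloured_covers_from_ascent[OF u j True less.prems(1) d]
      show ?thesis
      proof (cases "left_ascent j z")
        case True
        then show ?thesis using IH[of u z] c less.prems(2) z_up by blast
      next
        case False
        have "bruhat_le n u (swap_values j z)" by (rule lift_upper[OF less.prems(2) j True])
        then have "f \<circ> inv (swap_values j z) = f \<circ> inv u"
          using IH c z_down[OF False] by blast
        then have "f \<circ> inv z = f \<circ> inv (swap_values j u)"
          using colour_swap_values_cong[OF swap_values_permutes[OF z j] u, of f j] by simp
        then show ?thesis using c by simp
      qed
    next
      case du: False
      note c = coloured_covers_from_descent[OF u j du less.prems(1) d]
      show ?thesis
      proof (cases "left_ascent j z")
        case True
        (* Here u <= z <= s v, so both u and z lie in the shorter interval above s u. *)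
        have su: "bruhat_le n (swap_values j u) u" by (rule left_descent_le[OF u j du])
        have "f \<circ> inv u = f \<circ> inv (swap_values j u)"
          using IH[OF c su] less.prems(2) z_up[OF True] bruhat_le_trans by blast
        moreover have "f \<circ> inv z = f \<circ> inv (swap_values j u)"
          using IH[OF c _ z_up[OF True]] less.prems(2) su bruhat_le_trans by blast
        ultimately show ?thesis by simp
      next
        case False
        have "f \<circ> inv (swap_values j z) = f \<circ> inv (swap_values j u)"
          using IH[OF c descents_mono[OF less.prems(2) j du] z_down[OF False]] .
        then show ?thesis
          using colour_swap_values_cong[OF swap_values_permutes[OF z j] swap_values_permutes[OF u j], of f j]
          by simp
      qed
    qed
  qed
qed

section \<open>Maximal chains and their partition\<close>

lemma successively_rtranclp_nth:
  assumes "successively P C" "i \<le> k" "k < length C"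
  shows "P\<^sup>*\<^sup>* (C ! i) (C ! k)"
  using assms(2,3)
proof (induction rule: dec_induct)
  case (step k)
  then have "P (C ! k) (C ! Suc k)" using assms(1) by (auto simp: successively_conv_nth)
  then show ?case using step by (auto intro: rtranclp.rtrancl_into_rtrancl)
qed simp

text \<open>
  The first cover is an element of least length among those strictly above \<open>u\<close> and at most \<open>v\<close>.
\<close>

lemma exists_maximal_chain:
  assumes "bruhat_le n u v" shows "\<exists>C. maximal_chain n u v C"
  using assms
proof (induction "perm_length n v - perm_length n u" arbitrary: u rule: less_induct)
  case less
  note p = bruhat_le_permutes[OF less.prems]
  show ?case
  proof (cases "u = v")
    case True
    then show ?thesis using p by (intro exI[of _ "[u]"]) (simp add: maximal_chain_def)
  next
    case False
    let ?above = "\<lambda>w. bruhat_le n u w \<and> bruhat_le n w v \<and> w \<noteq> u"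
    define w where "w = arg_min (perm_length n) ?above"
    have "?above v" using less.prems False p bruhat_le_refl by auto
    then have w: "?above w" and least: "\<And>y. ?above y \<Longrightarrow> perm_length n w \<le> perm_length n y"
      unfolding w_def using arg_min_nat_lemma[of ?above v "perm_length n"] by blast+
    have cover: "bruhat_cover n u w"
      unfolding bruhat_cover_def
    proof (intro conjI allI impI)
      fix y assume y: "bruhat_le n u y \<and> bruhat_le n y w"
      show "y = u \<or> y = w"
      proof (rule ccontr)
        assume *: "\<not> ?thesis"
        then have "?above y" using y w bruhat_le_trans by blast
        from least[OF this] show False using perm_length_strict_mono[of n y w] y * by simp
      qed
    qed (use w in auto)
    have "perm_length n u < perm_length n w" "perm_length n u < perm_length n v"
      using w False less.prems perm_length_strict_mono by auto
    then obtain C where C: "maximal_chain n w v C" using less.hyps[of w] w by fastforce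
    then have "maximal_chain n u v (u # C)"
      using cover p by (auto simp: maximal_chain_def successively_Cons)
    then show ?thesis by blast
  qed
qed

lemma maximal_chain_nth:
  assumes C: "maximal_chain n u v C"
  shows "Suc i < length C \<Longrightarrow> bruhat_cover n (C ! i) (C ! Suc i)"
    and "i < length C \<Longrightarrow> bruhat_le n u (C ! i) \<and> bruhat_le n (C ! i) v"
proof -
  have s: "successively (bruhat_cover n) C" and ne: "C \<noteq> []" and u: "u permutes {1..n}"
    and h: "C ! 0 = u" and l: "C ! (length C - 1) = v"
    using C by (auto simp: maximal_chain_def hd_conv_nth last_conv_nth)
  show "bruhat_cover n (C ! i) (C ! Suc i)" if "Suc i < length C"
    using s that by (auto simp: successively_conv_nth)
  have le: "bruhat_le n x y" if "(bruhat_cover n)\<^sup>*\<^sup>* x y" "x permutes {1..n}" for x y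
    using that(1)
    by (induction rule: rtranclp_induct)
      (use that(2) bruhat_le_refl bruhat_cover_le bruhat_le_trans in blast)+
  show "bruhat_le n u (C ! i) \<and> bruhat_le n (C ! i) v" if "i < length C"
  proof -
    have "bruhat_le n u (C ! i)" using successively_rtranclp_nth[OF s, of 0 i] that h u le by auto
    moreover have "bruhat_le n (C ! i) v"
      using successively_rtranclp_nth[OF s, of i "length C - 1"] that l
        le bruhat_le_permutes(2)[OF calculation] by auto
    ultimately show ?thesis ..
  qed
qed

lemma colour_transposition_iff:
  assumes x: "x permutes {1..n}"
  shows "f \<circ> inv x = f \<circ> inv (x \<circ> transposition a b) \<longleftrightarrow> f a = f b"
proof
  have i: "inv (x \<circ> transposition a b) = transposition a b \<circ> inv x"
    using x by (simp add: o_inv_distrib permutes_bij)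
  show "f a = f b" if "f \<circ> inv x = f \<circ> inv (x \<circ> transposition a b)"
    using fun_cong[OF that, of "x a"] by (simp add: i permutes_inverses[OF x])
  show "f \<circ> inv x = f \<circ> inv (x \<circ> transposition a b)" if "f a = f b"
    using that by (auto simp: i fun_eq_iff Transposition.transpose_def)
qed

lemma chain_edge_obtain:
  assumes C: "maximal_chain n u v C" and e: "(a, b) \<in> chain_edges n C"
  obtains x where "bruhat_le n u x" "bruhat_le n x v"
    "bruhat_le n u (x \<circ> transposition a b)" "bruhat_le n (x \<circ> transposition a b) v"
proof -
  obtain i where i: "Suc i < length C" and t: "transposition a b = inv (C ! i) \<circ> C ! Suc i"
    using e by (auto simp: chain_edges_def)
  have b: "bruhat_le n u (C ! i) \<and> bruhat_le n (C ! i) v" using maximal_chain_nth(2)[OF C] i by simp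
  then have "C ! i permutes {1..n}" using bruhat_le_permutes by blast
  then have "C ! i \<circ> transposition a b = C ! Suc i"
    unfolding t by (simp add: o_assoc permutes_inv_o)
  then show thesis using that[of "C ! i"] b maximal_chain_nth(2)[OF C i] by simp
qed

lemma chain_colour_constant:
  assumes C: "maximal_chain n u v C" and f: "\<And>a b. (a, b) \<in> chain_edges n C \<Longrightarrow> f a = f b"
    and z: "bruhat_le n u z" "bruhat_le n z v"
  shows "f \<circ> inv z = f \<circ> inv u"
proof -
  have "coloured_cover n f (C ! i) (C ! Suc i)" if i: "Suc i < length C" for i
  proof -
    have c: "bruhat_cover n (C ! i) (C ! Suc i)" by (rule maximal_chain_nth(1)[OF C i])
    then have p: "C ! i permutes {1..n}" using bruhat_cover_le bruhat_le_permutes by blast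
    obtain a b where ab: "a \<in> {1..n}" "b \<in> {1..n}" "a \<noteq> b" "C ! Suc i = C ! i \<circ> transposition a b"
      using bruhat_cover_step[OF c] unfolding bruhat_step_def by blast
    then have "transposition a b = inv (C ! i) \<circ> C ! Suc i"
      by (simp add: o_assoc permutes_inv_o[OF p])
    then have "f a = f b" using f ab i unfolding chain_edges_def by blast
    then show ?thesis using c ab(4) colour_transposition_iff[OF p, of f a b] by (simp add: coloured_cover_def)
  qed
  then have "successively (coloured_cover n f) C" by (auto simp: successively_conv_nth)
  then have "(coloured_cover n f)\<^sup>*\<^sup>* (C ! 0) (C ! (length C - 1))"
    using C by (intro successively_rtranclp_nth) (auto simp: maximal_chain_def)
  then have "(coloured_cover n f)\<^sup>*\<^sup>* u v"
    using C by (auto simp: maximal_chain_def hd_conv_nth last_conv_nth)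
  then show ?thesis using z by (rule colour_constant_on_interval)
qed

lemma equiv_chain_edges: "equiv UNIV ((chain_edges n C)\<^sup>*)"
proof (rule equivI)
  show "sym ((chain_edges n C)\<^sup>*)"
    by (rule sym_rtrancl) (auto simp: sym_def chain_edges_def transpose_commute)
qed (auto simp: refl_rtrancl trans_rtrancl)

text \<open>
  Colour positions by the components of \<open>C\<close>. All elements of \<open>C'\<close> lie in the interval, so they have
  the same colours of values, and every edge of \<open>C'\<close> joins two positions of one component of \<open>C\<close>.
\<close>

lemma chain_edges_subset:
  assumes C: "maximal_chain n u v C" and C': "maximal_chain n u v C'"
  shows "chain_edges n C' \<subseteq> (chain_edges n C)\<^sup>*"
proof clarify
  fix a b assume "(a, b) \<in> chain_edges n C'"
  then obtain x where x: "bruhat_le n u x" "bruhat_le n x v"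
    "bruhat_le n u (x \<circ> transposition a b)" "bruhat_le n (x \<circ> transposition a b) v"
    by (rule chain_edge_obtain[OF C'])
  let ?f = "\<lambda>i. (chain_edges n C)\<^sup>* `` {i}"
  have "?f i = ?f k" if "(i, k) \<in> chain_edges n C" for i k
    using that by (intro equiv_class_eq[OF equiv_chain_edges]) auto
  then have const: "?f \<circ> inv z = ?f \<circ> inv u" if "bruhat_le n u z" "bruhat_le n z v" for z
    using that by (rule chain_colour_constant[OF C])
  have "?f \<circ> inv x = ?f \<circ> inv (x \<circ> transposition a b)"
    using const[OF x(1,2)] const[OF x(3,4)] by simp
  then have "?f a = ?f b" using colour_transposition_iff[OF bruhat_le_permutes(2)[OF x(1)], of ?f] by blast
  then show "(a, b) \<in> (chain_edges n C)\<^sup>*"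
    using eq_equiv_class[OF _ equiv_chain_edges] by blast
qed

lemma bruhat_partition_eq:
  assumes C: "maximal_chain n u v C"
  shows "bruhat_partition n u v = chain_partition n C"
  unfolding bruhat_partition_def
proof (rule the_equality)
  show "\<exists>C'. maximal_chain n u v C' \<and> chain_partition n C = chain_partition n C'" using C by blast
  fix B assume "\<exists>C'. maximal_chain n u v C' \<and> B = chain_partition n C'"
  then obtain C' where C': "maximal_chain n u v C'" and B: "B = chain_partition n C'" by blast
  have "(chain_edges n C)\<^sup>* = (chain_edges n C')\<^sup>*"
    using rtrancl_subset_rtrancl[OF chain_edges_subset[OF C C']]
      rtrancl_subset_rtrancl[OF chain_edges_subset[OF C' C]] by (rule subset_antisym[rotated])
  then show "B = chain_partition n C" by (simp add: B chain_partition_def)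
qed

section \<open>Vectors with prescribed block sums\<close>

text \<open>
  Choose a representative of each block. Subtracting from \<open>x\<close> the vector that moves each coordinate to
  the representative of its block leaves the block sums at the representatives, and they are all zero.
\<close>

lemma zero_block_sums_in_subspace:
  fixes c :: "'n::finite \<Rightarrow> 'c" and x :: "real ^ 'n"
  assumes W: "subspace W" and axes: "\<And>a b. c a = c b \<Longrightarrow> axis a 1 - axis b 1 \<in> W"
    and x: "\<And>k. (\<Sum>a | c a = k. x $ a) = 0"
  shows "x \<in> W"
proof -
  define r where "r k = (SOME a. c a = k)" for k
  have r: "c (r (c a)) = c a" for a unfolding r_def by (rule someI) simp
  have "(\<Sum>a\<in>UNIV. x $ a *\<^sub>R axis (r (c a)) (1::real))
      = (\<Sum>k\<in>range c. \<Sum>a | a \<in> UNIV \<and> c a = k. x $ a *\<^sub>R axis (r (c a)) (1::real))"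
    by (rule sum.image_gen) simp
  also have "\<dots> = (\<Sum>k\<in>range c. (\<Sum>a | c a = k. x $ a) *\<^sub>R axis (r k) (1::real))"
    by (intro sum.cong refl) (simp add: scaleR_sum_left)
  also have "\<dots> = 0" by (simp add: x)
  finally have "(\<Sum>a\<in>UNIV. x $ a *\<^sub>R axis (r (c a)) (1::real)) = 0" .
  moreover have "(\<Sum>a\<in>UNIV. x $ a *\<^sub>R axis a (1::real)) = x"
    by (simp add: basis_expansion flip: scalar_mult_eq_scaleR)
  ultimately have "x = (\<Sum>a\<in>UNIV. x $ a *\<^sub>R (axis a 1 - axis (r (c a)) 1))"
    by (simp add: scaleR_diff_right sum_subtractf)
  also have "\<dots> \<in> W"
    by (intro subspace_sum[OF W] subspace_scale[OF W] axes) (simp add: r)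
  finally show ?thesis .
qed

text \<open>
  The condition is orthogonality to the block indicators, which are nonzero and pairwise orthogonal.
\<close>

lemma dim_zero_block_sums:
  fixes c :: "'n::finite \<Rightarrow> 'c"
  shows "dim {x :: real ^ 'n. \<forall>k. (\<Sum>a | c a = k. x $ a) = 0} + card (range c) = CARD('n)"
proof -
  define ind :: "'c \<Rightarrow> real ^ 'n" where "ind k = (\<chi> a. if c a = k then 1 else 0)" for k
  have inner: "ind k \<bullet> x = (\<Sum>a | c a = k. x $ a)" for k x
    by (simp add: ind_def inner_vec_def if_distrib[of "\<lambda>t. t * _"] sum.If_cases)
  have nz: "ind (c a) $ a = 1" for a by (simp add: ind_def)
  have orth: "orthogonal (ind k) (ind l)" if "k \<noteq> l" for k l
    using that unfolding orthogonal_def inner by (auto simp: ind_def intro: sum.neutral)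
  have inj: "inj_on ind (range c)"
  proof (rule inj_onI)
    fix k l assume "k \<in> range c" and eq: "ind k = ind l"
    then obtain a where k: "k = c a" by blast
    have "ind l $ a = 1" using nz[of a] by (simp add: k flip: eq)
    then show "k = l" by (simp add: k ind_def split: if_splits)
  qed
  have "independent (ind ` range c)"
  proof (rule pairwise_orthogonal_independent)
    show "pairwise orthogonal (ind ` range c)"
    proof (rule pairwiseI)
      fix y z assume "y \<in> ind ` range c" "z \<in> ind ` range c" "y \<noteq> z"
      then obtain k l where kl: "y = ind k" "z = ind l" by blast
      with \<open>y \<noteq> z\<close> have "k \<noteq> l" by blast
      then show "orthogonal y z" unfolding kl by (rule orth)
    qed
    show "0 \<notin> ind ` range c"
    proof
      assume "0 \<in> ind ` range c"
      then obtain a where "ind (c a) = 0" by auto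
      then show False using nz[of a] by simp
    qed
  qed
  then have "dim (span (ind ` range c)) = card (range c)"
    by (simp add: dim_eq_card_independent card_image[OF inj])
  moreover have "{x. \<forall>k. (\<Sum>a | c a = k. x $ a) = 0}
      = {x \<in> UNIV. \<forall>y \<in> span (ind ` range c). orthogonal y x}" (is "?L = ?R")
  proof
    have "orthogonal y x"
      if x: "\<forall>k. (\<Sum>a | c a = k. x $ a) = 0" and y: "y \<in> span (ind ` range c)" for x y :: "real ^ 'n"
    proof -
      have "orthogonal x y"
        by (rule orthogonal_to_span[OF y]) (use x in \<open>auto simp: orthogonal_def inner inner_commute[of x]\<close>)
      then show ?thesis by (simp add: orthogonal_commute)
    qed
    then show "?L \<subseteq> ?R" by blast
    show "?R \<subseteq> ?L"
    proof clarify
      fix x :: "real ^ 'n" and k assume x: "\<forall>y \<in> span (ind ` range c). orthogonal y x"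
      show "(\<Sum>a | c a = k. x $ a) = 0"
      proof (cases "k \<in> range c")
        case True
        then have "ind k \<in> span (ind ` range c)" by (intro span_base) simp
        then show ?thesis using x by (simp add: orthogonal_def flip: inner)
      next
        case False
        then have "{a. c a = k} = {}" by auto
        then show ?thesis by simp
      qed
    qed
  qed
  ultimately show ?thesis
    using dim_subspace_orthogonal_to_vectors[of "span (ind ` range c)" "UNIV :: (real ^ 'n) set"]
    by simp
qed

section \<open>The affine hull of a Bruhat interval polytope\<close>

text \<open>
  Reindexing by values shows that a block sum depends on \<open>z\<close> only through \<open>f \<circ> inv z\<close>.
\<close>

lemma sum_colour_class:
  assumes z: "z permutes {1..n}"
  shows "(\<Sum>i | i \<in> {1..n} \<and> f i = k. real (z i)) = (\<Sum>l | l \<in> {1..n} \<and> (f \<circ> inv z) l = k. real l)"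
  using permutes_in_image[OF z] permutes_in_image[OF permutes_inv[OF z]]
  by (intro sum.reindex_bij_witness[of _ "inv z" z])
    (auto simp del: One_nat_def simp: permutes_inverses[OF z])

theorem theorem4p6:
  fixes n :: nat and e :: "nat \<Rightarrow> 'n::finite" and u v :: "nat \<Rightarrow> nat"
  assumes "bij_betw e {1..n} (UNIV :: 'n set)"
    and "bruhat_le n u v"
  shows "aff_dim (bruhat_interval_polytope n e u v) = int n - int (card (bruhat_partition n u v))
    \<and> affine hull (bruhat_interval_polytope n e u v) =
        {x. \<forall>B \<in> bruhat_partition n u v. (\<Sum>i\<in>B. x $ e i) = (\<Sum>i\<in>B. real (u i))}
    \<and> (\<forall>B \<in> bruhat_partition n u v. (\<Sum>i\<in>B. real (u i)) = (\<Sum>i\<in>B. real (v i)))"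
proof -
  obtain C where C: "maximal_chain n u v C" using exists_maximal_chain[OF assms(2)] by blast
  (* Positions are coloured by their component f; d labels coordinates by positions, and c is
     the induced colouring of coordinates. *)
  define E where "E = chain_edges n C"
  define f where "f i = E\<^sup>* `` {i}" for i
  define d where "d = inv_into {1..n} e"
  define c where "c = f \<circ> d"
  define point where "point z = (\<chi> a. real (z (d a)))" for z :: "nat \<Rightarrow> nat"
  define I where "I = {z. bruhat_le n u z \<and> bruhat_le n z v}"
  define L where "L = {x :: real ^ 'n. \<forall>k. (\<Sum>a | c a = k. x $ a) = 0}"
  define W where "W = span ((\<lambda>x. - point u + x) ` point ` I)"

  have de: "d (e i) = i" if "i \<in> {1..n}" for i
    unfolding d_def by (rule bij_betw_inv_into_left[OF assms(1) that])
  have ed: "e (d a) = a" for a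
    unfolding d_def by (rule bij_betw_inv_into_right[OF assms(1)]) simp
  have d_in: "d a \<in> {1..n}" for a
    using bij_betw_inv_into[OF assms(1)] unfolding d_def bij_betw_def by blast
  have range_d: "range d = {1..n}"
    using bij_betw_inv_into[OF assms(1)] by (simp add: d_def bij_betw_def)
  have n: "CARD('n) = n" using bij_betw_same_card[OF assms(1)] by simp

  have f_eq_iff: "f i = f k \<longleftrightarrow> (i, k) \<in> E\<^sup>*" for i k
    unfolding f_def E_def by (rule eq_equiv_class_iff[OF equiv_chain_edges]) auto
  have partition: "bruhat_partition n u v = range c"
  proof -
    have "bruhat_partition n u v = f ` {1..n}"
      unfolding bruhat_partition_eq[OF C] chain_partition_def quotient_def f_def E_def by blast
    then show ?thesis unfolding c_def image_comp[symmetric] range_d .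
  qed
  have block: "B = {i \<in> {1..n}. f i = B}" if "B \<in> range c" for B
  proof -
    obtain i where i: "i \<in> {1..n}" and B: "B = f i" using \<open>B \<in> range c\<close> d_in by (auto simp: c_def)
    have "k \<in> {1..n}" if "(i, k) \<in> E\<^sup>*" for k
      using that i by (induction rule: rtrancl_induct) (auto simp: E_def chain_edges_def)
    then show ?thesis unfolding B f_eq_iff[of _ i]
      using f_eq_iff[of _ i] f_eq_iff[of i] by (auto simp: f_def)
  qed
  have sum_coords: "(\<Sum>a | c a = k. g (d a)) = (\<Sum>i | i \<in> {1..n} \<and> f i = k. g i)"
    for k and g :: "nat \<Rightarrow> real"
    using d_in by (intro sum.reindex_bij_witness[of _ e d]) (auto simp: de ed c_def)
  have sum_block: "(\<Sum>a | c a = B. g (d a)) = (\<Sum>i\<in>B. g i)"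
    if "B \<in> range c" for B and g :: "nat \<Rightarrow> real"
    unfolding sum_coords using block[OF that] by simp

  have colour: "f \<circ> inv z = f \<circ> inv u" if "z \<in> I" for z
    by (rule chain_colour_constant[OF C]) (use that in \<open>auto simp: f_eq_iff E_def I_def\<close>)
  have uI: "u \<in> I" and vI: "v \<in> I"
    using assms(2) bruhat_le_refl bruhat_le_permutes by (auto simp: I_def)
  have perm: "z permutes {1..n}" if "z \<in> I" for z
    using that bruhat_le_permutes(1) unfolding I_def by blast
  have block_sums: "(\<Sum>a | c a = k. real (z (d a))) = (\<Sum>a | c a = k. real (u (d a)))"
    if "z \<in> I" for z k
    unfolding sum_coords[where g = "\<lambda>i. real (z i)"] sum_coords[where g = "\<lambda>i. real (u i)"]
      sum_colour_class[OF perm[OF that]] sum_colour_class[OF perm[OF uI]] colour[OF that] ..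

  have polytope: "bruhat_interval_polytope n e u v = convex hull (point ` I)"
  proof -
    have "x = point z \<longleftrightarrow> (\<forall>i\<in>{1..n}. x $ e i = real (z i))" for x z
      unfolding point_def vec_eq_iff using d_in de ed by (metis vec_lambda_beta)
    then show ?thesis unfolding bruhat_interval_polytope_def I_def
      by (intro arg_cong[of _ _ "(hull) convex"]) auto
  qed

  have subspace_L: "subspace L"
    by (auto simp: L_def subspace_def sum.distrib sum_distrib_left[symmetric])
  have W_L: "W = L"
  proof
    show "W \<subseteq> L" unfolding W_def
    proof (intro span_minimal subspace_L, clarify)
      fix z assume "z \<in> I"
      then show "- point u + point z \<in> L"
        using block_sums by (simp add: L_def point_def sum_subtractf)
    qed
    have W: "subspace W" by (simp add: W_def)
    have diff: "point y - point x \<in> W" if "x \<in> I" "y \<in> I" for x y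
    proof -
      have "(- point u + point y) - (- point u + point x) \<in> W"
        unfolding W_def by (intro span_diff span_base) (use that in auto)
      then show ?thesis by simp
    qed
    have edge: "axis (e a) 1 - axis (e b) 1 \<in> W" if ab: "(a, b) \<in> E" for a b
    proof -
      have in_n: "a \<in> {1..n}" "b \<in> {1..n}" and "a \<noteq> b" using ab by (auto simp: E_def chain_edges_def)
      obtain x where x: "x \<in> I" "x \<circ> transposition a b \<in> I"
        using chain_edge_obtain[OF C] ab unfolding E_def I_def by blast
      have "x a \<noteq> x b" using inj_eq[OF permutes_inj[OF perm[OF x(1)]]] \<open>a \<noteq> b\<close> by simp
      have "point (x \<circ> transposition a b) - point x
          = (real (x b) - real (x a)) *\<^sub>R (axis (e a) 1 - axis (e b) 1)"
      proof (subst vec_eq_iff, intro allI)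
        fix k
        have "d k = i \<longleftrightarrow> k = e i" if "i \<in> {1..n}" for i using that de ed by metis
        then show "(point (x \<circ> transposition a b) - point x) $ k
            = ((real (x b) - real (x a)) *\<^sub>R (axis (e a) 1 - axis (e b) 1)) $ k"
          using in_n \<open>a \<noteq> b\<close> de by (auto simp: point_def axis_def Transposition.transpose_def)
      qed
      with diff[OF x] have "(real (x b) - real (x a)) *\<^sub>R (axis (e a) 1 - axis (e b) 1) \<in> W" by simp
      then have "inverse (real (x b) - real (x a)) *\<^sub>R
          ((real (x b) - real (x a)) *\<^sub>R (axis (e a) 1 - axis (e b) 1)) \<in> W"
        by (rule subspace_scale[OF W])
      then show ?thesis using \<open>x a \<noteq> x b\<close> by simp
    qed
    have path: "axis (e a) 1 - axis (e b) 1 \<in> W" if "(a, b) \<in> E\<^sup>*" for a b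
      using that
    proof (induction rule: rtrancl_induct)
      case base
      show ?case by (simp add: subspace_0[OF W])
    next
      case (step b b')
      then show ?case using subspace_add[OF W step.IH edge[OF step.hyps(2)]] by simp
    qed
    show "L \<subseteq> W"
    proof
      fix x assume "x \<in> L"
      then have "(\<Sum>a | c a = k. x $ a) = 0" for k unfolding L_def by blast
      moreover have "axis a 1 - axis b 1 \<in> W" if "c a = c b" for a b
        using path[of "d a" "d b"] that by (simp add: c_def f_eq_iff ed)
      ultimately show "x \<in> W" using zero_block_sums_in_subspace[OF W, of c x] by blast
    qed
  qed

  have u_hull: "point u \<in> affine hull (point ` I)" using uI by (intro hull_inc) auto
  have "aff_dim (point ` I) = int (dim L)"
    using aff_dim_eq_dim[OF u_hull] unfolding W_L[symmetric] W_def by (simp add: dim_span)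
  then have "aff_dim (bruhat_interval_polytope n e u v) = int n - int (card (bruhat_partition n u v))"
    using dim_zero_block_sums[of c] by (simp add: polytope aff_dim_convex_hull partition L_def n)
  moreover have "affine hull (bruhat_interval_polytope n e u v) =
      {x. \<forall>B \<in> bruhat_partition n u v. (\<Sum>i\<in>B. x $ e i) = (\<Sum>i\<in>B. real (u i))}"
  proof -
    have "affine hull (bruhat_interval_polytope n e u v) = (+) (point u) ` L"
      unfolding polytope affine_hull_convex_hull affine_hull_span_gen[OF u_hull] W_L[symmetric] W_def ..
    also have "\<dots> = {x. x - point u \<in> L}"
    proof (intro set_eqI iffI)
      fix x assume "x \<in> {x. x - point u \<in> L}"
      then show "x \<in> (+) (point u) ` L" by (intro image_eqI[of _ _ "x - point u"]) auto
    qed auto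
    also have "\<dots> = {x. \<forall>B\<in>range c. (\<Sum>a | c a = B. x $ a) = (\<Sum>a | c a = B. real (u (d a)))}"
    proof -
      have "x - point u \<in> L \<longleftrightarrow> (\<forall>k. (\<Sum>a | c a = k. x $ a) = (\<Sum>a | c a = k. real (u (d a))))" for x
        by (simp add: L_def point_def sum_subtractf)
      moreover have "(\<Sum>a | c a = k. x $ a) = (\<Sum>a | c a = k. real (u (d a)))"
        if "k \<notin> range c" for k and x :: "real ^ 'n"
      proof -
        have "{a. c a = k} = {}" using that by blast
        then show ?thesis by simp
      qed
      ultimately show ?thesis by blast
    qed
    also have "\<dots> = {x. \<forall>B \<in> range c. (\<Sum>i\<in>B. x $ e i) = (\<Sum>i\<in>B. real (u i))}"
      using sum_block[where g = "\<lambda>i. _ $ e i"] sum_block[where g = "\<lambda>i. real (u i)"] by (simp add: ed)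
    finally show ?thesis by (simp add: partition)
  qed
  moreover have "\<forall>B \<in> bruhat_partition n u v. (\<Sum>i\<in>B. real (u i)) = (\<Sum>i\<in>B. real (v i))"
    unfolding partition using block_sums[OF vI] sum_block[where g = "\<lambda>i. real (u i)"]
      sum_block[where g = "\<lambda>i. real (v i)"] by simp
  ultimately show ?thesis by blast
qed

end
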